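(* Let $T_1, T_2 \in \mathscr{B}(\mathscr{H})$ be analytic left invertible operators, each with Fredholm index $-1$, and let $\mathfrak{A}_i = \mathfrak{A}_{T_i}$ for $i = 1,2$. Suppose $\phi: \mathfrak{A}_1 \to \mathfrak{A}_2$ is a bounded (algebra) isomorphism. Then there exists an invertible $V \in \mathscr{B}(\mathscr{H})$ such that $\phi(A) = VAV^{-1}$ for all $A \in \mathfrak{A}_1$.
   Context: $\mathscr{H}$ is a complex Hilbert space. For a left invertible $T$, its Moore–Penrose inverse is $T^\dagger = (T^*T)^{-1}T^*$, and $\mathfrak{A}_T$ denotes the norm-closed algebra generated by $T$ and $T^\dagger$ (i.e. the operator-norm closure of the algebra of polynomials in $T$ and $T^\dagger$). A left invertible $T$ is analytic if $\bigcap_{n\ge 1} T^n\mathscr{H} = \{0\}$. *)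

theory Defs
  imports "HOL-Analysis.Analysis"
begin

class complex_hilbert = banach +
  fixes scaleC :: "complex \<Rightarrow> 'a \<Rightarrow> 'a"
    and cinner :: "'a \<Rightarrow> 'a \<Rightarrow> complex"
  assumes scaleC_of_real: "scaleC (of_real r) x = scaleR r x"
    and scaleC_add_right: "scaleC a (x + y) = scaleC a x + scaleC a y"
    and scaleC_add_left: "scaleC (a + b) x = scaleC a x + scaleC b x"
    and scaleC_scaleC: "scaleC a (scaleC b x) = scaleC (a * b) x"
    and scaleC_one: "scaleC 1 x = x"
    and cinner_conj: "cinner x y = cnj (cinner y x)"
    and cinner_add_right: "cinner x (y + z) = cinner x y + cinner x z"
    and cinner_scaleC_right: "cinner x (scaleC a y) = a * cinner x y"
    and norm_cinner: "norm x = sqrt (Re (cinner x x))"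

definition bop :: "('a::complex_hilbert \<Rightarrow> 'a) \<Rightarrow> bool" where
  "bop T \<longleftrightarrow> bounded_linear T \<and> (\<forall>c x. T (scaleC c x) = scaleC c (T x))"

definition adj :: "('a::complex_hilbert \<Rightarrow> 'a) \<Rightarrow> ('a \<Rightarrow> 'a)" where
  "adj T = (\<lambda>y. THE z. \<forall>x. cinner (T x) y = cinner x z)"

definition left_invertible :: "('a::complex_hilbert \<Rightarrow> 'a) \<Rightarrow> bool" where
  "left_invertible T \<longleftrightarrow> bop T \<and> (\<exists>S. bop S \<and> S \<circ> T = id)"

definition invertible_op :: "('a::complex_hilbert \<Rightarrow> 'a) \<Rightarrow> bool" where
  "invertible_op V \<longleftrightarrow> bop V \<and> (\<exists>W. bop W \<and> W \<circ> V = id \<and> V \<circ> W = id)"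

text \<open>Moore--Penrose inverse of a left invertible T: (T* T)^{-1} T*.\<close>
definition mp_inv :: "('a::complex_hilbert \<Rightarrow> 'a) \<Rightarrow> ('a \<Rightarrow> 'a)" where
  "mp_inv T = inv (adj T \<circ> T) \<circ> adj T"

definition analytic_op :: "('a::complex_hilbert \<Rightarrow> 'a) \<Rightarrow> bool" where
  "analytic_op T \<longleftrightarrow> (\<Inter>n\<in>{1..}. range (T ^^ n)) = {0}"

definition cfin_dim :: "'a::complex_hilbert set \<Rightarrow> bool" where
  "cfin_dim S \<longleftrightarrow> (\<exists>B. finite B \<and> module.span scaleC B = S)"

definition cdim :: "'a::complex_hilbert set \<Rightarrow> nat" where
  "cdim S = vector_space.dim scaleC S"

definition kernel :: "('a::complex_hilbert \<Rightarrow> 'a) \<Rightarrow> 'a set" where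
  "kernel T = {x. T x = 0}"

definition fredholm :: "('a::complex_hilbert \<Rightarrow> 'a) \<Rightarrow> bool" where
  "fredholm T \<longleftrightarrow> bop T \<and> closed (range T) \<and> cfin_dim (kernel T) \<and> cfin_dim (kernel (adj T))"

text \<open>ind T = dim ker T - dim ker T* (= dim ker T - dim coker T for closed range).\<close>
definition fredholm_index :: "('a::complex_hilbert \<Rightarrow> 'a) \<Rightarrow> int" where
  "fredholm_index T = int (cdim (kernel T)) - int (cdim (kernel (adj T)))"

inductive_set alg_gen :: "('a::complex_hilbert \<Rightarrow> 'a) \<Rightarrow> ('a \<Rightarrow> 'a) \<Rightarrow> ('a \<Rightarrow> 'a) set"
  for T S where
    gen_T: "T \<in> alg_gen T S"
  | gen_S: "S \<in> alg_gen T S"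
  | gen_add: "A \<in> alg_gen T S \<Longrightarrow> B \<in> alg_gen T S \<Longrightarrow> (\<lambda>x. A x + B x) \<in> alg_gen T S"
  | gen_smult: "A \<in> alg_gen T S \<Longrightarrow> (\<lambda>x. scaleC c (A x)) \<in> alg_gen T S"
  | gen_mult: "A \<in> alg_gen T S \<Longrightarrow> B \<in> alg_gen T S \<Longrightarrow> A \<circ> B \<in> alg_gen T S"

definition mp_alg :: "('a::complex_hilbert \<Rightarrow> 'a) \<Rightarrow> ('a \<Rightarrow> 'a) set" where
  "mp_alg T = {A. bop A \<and> (\<forall>e>0. \<exists>B\<in>alg_gen T (mp_inv T). onorm (\<lambda>x. A x - B x) < e)}"

definition bounded_alg_iso ::
  "(('a::complex_hilbert \<Rightarrow> 'a) \<Rightarrow> ('a \<Rightarrow> 'a)) \<Rightarrow> ('a \<Rightarrow> 'a) set \<Rightarrow> ('a \<Rightarrow> 'a) set \<Rightarrow> bool" where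
  "bounded_alg_iso \<phi> \<A> \<B> \<longleftrightarrow>
     bij_betw \<phi> \<A> \<B> \<and>
     (\<forall>A\<in>\<A>. \<forall>B\<in>\<A>. \<phi> (\<lambda>x. A x + B x) = (\<lambda>x. \<phi> A x + \<phi> B x)) \<and>
     (\<forall>A\<in>\<A>. \<forall>c. \<phi> (\<lambda>x. scaleC c (A x)) = (\<lambda>x. scaleC c (\<phi> A x))) \<and>
     (\<forall>A\<in>\<A>. \<forall>B\<in>\<A>. \<phi> (A \<circ> B) = \<phi> A \<circ> \<phi> B) \<and>
     (\<exists>K. \<forall>A\<in>\<A>. onorm (\<phi> A) \<le> K * onorm A)"

end

theory Submission
  imports Defs
begin

text \<open>
  Write \<open>rank_one u g\<close> for the operator \<open>x \<mapsto> \<langle>g, x\<rangle> u\<close>, and let \<open>e\<close> be a unit vector spanning \<open>ker T*\<close>, so that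
  \<open>I - T T\<dagger> = rank_one e e\<close>. The vectors \<open>g\<close> with \<open>rank_one e g \<in> mp_alg T\<close> form a closed subspace containing
  \<open>(T\<dagger>)*\<^sup>n e\<close> for all \<open>n\<close>; a vector \<open>y\<close> orthogonal to it satisfies \<open>y = T\<^sup>n T\<dagger>\<^sup>n y\<close> for all \<open>n\<close>, so \<open>y = 0\<close> by analyticity,
  and \<open>rank_one e g \<in> mp_alg T\<close> for every \<open>g\<close>. (The vectors \<open>T\<^sup>n e\<close> need not span a dense subspace, so the
  algebra need not contain all compact operators; only its right ideal \<open>{rank_one e g}\<close> is used.)

  An isomorphism \<open>\<phi>\<close> carries this right ideal onto \<open>{rank_one v h}\<close>, where \<open>v\<close> spans the range of
  \<open>\<phi> (rank_one e e)\<close>. This yields a bounded bijection \<open>W\<close> with \<open>\<phi> (rank_one e g) = rank_one v (W g)\<close>.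
  Multiplying by \<open>A\<close> on the right gives \<open>W A* = \<phi>(A)* W\<close>, so \<open>V = (W\<^sup>-\<^sup>1)*\<close> implements \<open>\<phi>\<close>.
\<close>

section \<open>Complex Hilbert spaces\<close>

interpretation cvs: vector_space "scaleC :: complex \<Rightarrow> 'a::complex_hilbert \<Rightarrow> 'a"
  by unfold_locales (simp_all add: scaleC_add_right scaleC_add_left scaleC_scaleC scaleC_one)

section \<open>Inner product identities and the Cauchy-Schwarz inequality\<close>

lemma cinner_zero_right [simp]: "cinner (x::'a::complex_hilbert) 0 = 0"
  using cinner_add_right[of x 0 0] by simp

lemma cinner_add_left: "cinner (x + y) (z::'a::complex_hilbert) = cinner x z + cinner y z"
  by (metis cinner_add_right cinner_conj complex_cnj_add)

lemma cinner_scaleC_left: "cinner (scaleC a x) (y::'a::complex_hilbert) = cnj a * cinner x y"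
  by (metis cinner_conj cinner_scaleC_right complex_cnj_mult)

lemma cinner_zero_left [simp]: "cinner 0 (x::'a::complex_hilbert) = 0"
  using cinner_add_left[of 0 0 x] by simp

lemma cinner_minus_right: "cinner x (- y) = - cinner x (y::'a::complex_hilbert)"
  using cinner_add_right[of x y "- y"] by (simp add: eq_neg_iff_add_eq_0 add.commute)

lemma cinner_minus_left: "cinner (- x) y = - cinner x (y::'a::complex_hilbert)"
  using cinner_add_left[of x "- x" y] by (simp add: eq_neg_iff_add_eq_0 add.commute)

lemma cinner_diff_right: "cinner x (y - z) = cinner x y - cinner x (z::'a::complex_hilbert)"
  using cinner_add_right[of x y "- z"] by (simp add: cinner_minus_right)

lemma cinner_diff_left: "cinner (x - y) z = cinner x z - cinner y (z::'a::complex_hilbert)"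
  using cinner_add_left[of x "- y" z] by (simp add: cinner_minus_left)

text \<open>Positivity is not a class axiom: it follows because the norm, a square root of the real
  part, is nonnegative. Conjugate symmetry removes the imaginary part.\<close>

lemma cinner_self: "cinner x x = of_real ((norm (x::'a::complex_hilbert))\<^sup>2)"
proof -
  have n: "norm x = sqrt (Re (cinner x x))" by (rule norm_cinner)
  have "0 \<le> Re (cinner x x)"
    using norm_ge_zero[of x] unfolding n by (simp only: real_sqrt_ge_0_iff)
  then have "Re (cinner x x) = (norm x)\<^sup>2" by (simp add: n)
  moreover have "Im (cinner x x) = 0"
    using arg_cong[OF cinner_conj[of x x], of Im] by simp
  ultimately show ?thesis by (simp add: complex_eq_iff)
qed

lemma cinner_eq_zero_iff [simp]: "cinner x x = 0 \<longleftrightarrow> x = (0::'a::complex_hilbert)"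
  by (simp add: cinner_self)

lemma cinner_ext:
  assumes "\<And>x. cinner y x = cinner z (x::'a::complex_hilbert)"
  shows "y = z"
proof -
  have "cinner (y - z) (y - z) = 0" by (simp add: cinner_diff_left assms)
  then show ?thesis by simp
qed

lemma norm_add_sq:
  "(norm (x + y))\<^sup>2 = (norm x)\<^sup>2 + (norm y)\<^sup>2 + 2 * Re (cinner x (y::'a::complex_hilbert))"
proof -
  have "Re (cinner y x) = Re (cinner x y)"
    by (subst cinner_conj) simp
  moreover have "Re (cinner (x + y) (x + y)) = Re (cinner x x) + Re (cinner y y) + Re (cinner x y) + Re (cinner y x)"
    unfolding cinner_add_left cinner_add_right by simp
  ultimately show ?thesis unfolding cinner_self Re_complex_of_real by linarith
qed

lemma norm_diff_sq:
  "(norm (x - y))\<^sup>2 = (norm x)\<^sup>2 + (norm y)\<^sup>2 - 2 * Re (cinner x (y::'a::complex_hilbert))"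
  using norm_add_sq[of x "- y"] by (simp only: diff_conv_add_uminus cinner_minus_right norm_minus_cancel) simp

lemma norm_scaleC [simp]: "norm (scaleC c x) = cmod c * norm (x::'a::complex_hilbert)"
proof -
  have "cinner (scaleC c x) (scaleC c x) = (c * cnj c) * cinner x x"
    by (simp add: cinner_scaleC_left cinner_scaleC_right)
  also have "\<dots> = of_real ((cmod c * norm x)\<^sup>2)"
    by (simp only: complex_norm_square[symmetric] cinner_self of_real_mult[symmetric] power_mult_distrib)
  finally show ?thesis
    by (simp only: cinner_self of_real_eq_iff power2_eq_iff_nonneg norm_ge_zero mult_nonneg_nonneg)
qed

text \<open>Cauchy-Schwarz: by Pythagoras the projection \<open>scaleC c x\<close> of
  \<open>y\<close> onto the line of \<open>x\<close> is no longer than \<open>y\<close>.\<close>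

lemma cinner_norm_le: "cmod (cinner x y) \<le> norm x * norm (y::'a::complex_hilbert)"
proof (cases "x = 0")
  case False
  define c where "c = cinner x y / cinner x x"
  have nx: "norm x > 0" using False by simp
  have "cinner x (y - scaleC c x) = 0"
    using False by (simp add: c_def cinner_diff_right cinner_scaleC_right)
  then have "cinner (scaleC c x) (y - scaleC c x) = 0" by (simp add: cinner_scaleC_left)
  then have "(norm y)\<^sup>2 = (norm (scaleC c x))\<^sup>2 + (norm (y - scaleC c x))\<^sup>2"
    using norm_add_sq[of "scaleC c x" "y - scaleC c x"] by simp
  then have "(norm (scaleC c x))\<^sup>2 \<le> (norm y)\<^sup>2" by simp
  then have "norm (scaleC c x) \<le> norm y" by (simp add: power2_le_iff_abs_le)
  moreover have "norm (scaleC c x) = cmod (cinner x y) / norm x"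
    using nx by (simp add: c_def norm_divide norm_mult cinner_self power2_eq_square)
  ultimately show ?thesis using nx by (simp add: divide_le_eq mult.commute)
qed simp

section \<open>Nearest points and orthogonal decomposition\<close>

definition csubspace :: "'a::complex_hilbert set \<Rightarrow> bool" where
  "csubspace M \<longleftrightarrow> 0 \<in> M \<and> (\<forall>x\<in>M. \<forall>y\<in>M. x + y \<in> M) \<and> (\<forall>c. \<forall>x\<in>M. scaleC c x \<in> M)"

lemma csubspace_scaleR: "csubspace M \<Longrightarrow> x \<in> M \<Longrightarrow> scaleR r x \<in> M"
  unfolding csubspace_def by (metis scaleC_of_real)

text \<open>A minimizing sequence is Cauchy by the parallelogram law, since midpoints of its members
  stay in \<open>M\<close> and so keep distance at least \<open>d\<close> from
  \<open>x\<close>.\<close>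

lemma nearest_point_exists:
  fixes M :: "'a::complex_hilbert set"
  assumes M: "csubspace M" and cl: "closed M"
  shows "\<exists>p\<in>M. \<forall>m\<in>M. norm (x - p) \<le> norm (x - m)"
proof -
  define d where "d = Inf ((\<lambda>m. norm (x - m)) ` M)"
  have ne: "M \<noteq> {}" using M by (auto simp: csubspace_def)
  have bb: "bdd_below ((\<lambda>m. norm (x - m)) ` M)" by (rule bdd_belowI[of _ 0]) auto
  have d_le: "d \<le> norm (x - m)" if "m \<in> M" for m
    unfolding d_def using that bb by (auto intro: cInf_lower)
  have d0: "0 \<le> d" unfolding d_def by (rule cInf_greatest) (use ne in auto)
  have "\<exists>m\<in>M. norm (x - m) < d + 1 / Suc n" for n
  proof -
    have "Inf ((\<lambda>m. norm (x - m)) ` M) < d + 1 / Suc n" by (simp add: d_def)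
    then show ?thesis using ne cInf_lessD[of "(\<lambda>m. norm (x - m)) ` M"] by auto
  qed
  then obtain p where pM: "\<And>n. p n \<in> M" and p: "\<And>n. norm (x - p n) < d + 1 / Suc n" by metis
  \<comment> \<open>For \<open>t \<le> 1\<close>,
    \<open>(d + t)\<^sup>2 \<le> d\<^sup>2 + (2 * d + 1) * t\<close>. In the parallelogram law the
    terms \<open>4 * d\<^sup>2\<close> cancel and these errors, doubled, remain.\<close>
  have est: "(norm (p m - p n))\<^sup>2 \<le> 2 * (2 * d + 1) * (1 / Suc m + 1 / Suc n)" for m n
  proof -
    define u where "u = x - p m"
    define v where "v = x - p n"
    have par: "(norm (u - v))\<^sup>2 + (norm (u + v))\<^sup>2 = 2 * (norm u)\<^sup>2 + 2 * (norm v)\<^sup>2"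
      by (simp add: norm_add_sq norm_diff_sq)
    have mid: "scaleR (1/2) (p m + p n) \<in> M"
      by (rule csubspace_scaleR[OF M]) (use M pM in \<open>auto simp: csubspace_def\<close>)
    have "u + v = scaleR 2 (x - scaleR (1/2) (p m + p n))"
      by (simp add: u_def v_def algebra_simps scaleR_2)
    then have "norm (u + v) \<ge> 2 * d" using d_le[OF mid] by simp
    then have uv: "(norm (u + v))\<^sup>2 \<ge> 4 * d\<^sup>2" using d0 power_mono[of "2*d" "norm (u + v)" 2] by simp
    have sq: "(norm w)\<^sup>2 \<le> d\<^sup>2 + (2 * d + 1) * t" if "norm w < d + t" "0 \<le> t" "t \<le> 1" for w :: 'a and t
    proof -
      have "(norm w)\<^sup>2 \<le> (d + t)\<^sup>2" using that by (intro power_mono) auto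
      moreover have "t\<^sup>2 \<le> t" using that by (simp add: power2_eq_square mult_left_le)
      ultimately show ?thesis by (simp add: power2_sum algebra_simps)
    qed
    have "(norm u)\<^sup>2 \<le> d\<^sup>2 + (2 * d + 1) * (1 / Suc m)" unfolding u_def by (rule sq[OF p]) auto
    moreover have "(norm v)\<^sup>2 \<le> d\<^sup>2 + (2 * d + 1) * (1 / Suc n)" unfolding v_def by (rule sq[OF p]) auto
    moreover have "norm (u - v) = norm (p m - p n)" by (simp add: u_def v_def norm_minus_commute)
    moreover have "2 * (2 * d + 1) * (a + b) = 2 * ((2 * d + 1) * a) + 2 * ((2 * d + 1) * b)" for a b :: real
      by algebra
    ultimately show ?thesis using par uv by (smt (verit))
  qed
  have "Cauchy p"
  proof (rule CauchyI)
    fix e :: real assume e: "e > 0"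
    obtain N where "4 * (2 * d + 1) / e\<^sup>2 < real N" using reals_Archimedean2 by blast
    then have N: "4 * (2 * d + 1) / e\<^sup>2 < Suc N" by simp
    show "\<exists>N. \<forall>m\<ge>N. \<forall>n\<ge>N. norm (p m - p n) < e"
    proof (intro exI allI impI)
      fix m n assume mn: "N \<le> m" "N \<le> n"
      have "1 / real (Suc m) \<le> 1 / Suc N" "1 / real (Suc n) \<le> 1 / Suc N"
        using mn by (auto simp: frac_le)
      then have "2 * (2 * d + 1) * (1 / Suc m + 1 / Suc n) \<le> 2 * (2 * d + 1) * (1 / Suc N + 1 / Suc N)"
        using d0 by (intro mult_left_mono) auto
      also have "\<dots> = 4 * (2 * d + 1) / Suc N" by simp
      also have "\<dots> < e\<^sup>2" using N e by (simp add: divide_less_eq mult.commute)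
      finally have "(norm (p m - p n))\<^sup>2 < e\<^sup>2" using est[of m n] by linarith
      then show "norm (p m - p n) < e" using e by (simp add: power2_less_imp_less)
    qed
  qed
  then obtain l where l: "p \<longlonglongrightarrow> l" using Cauchy_convergent_iff convergent_def by blast
  have "l \<in> M" using cl pM l closed_sequentially by blast
  moreover have "norm (x - l) \<le> d"
  proof (rule LIMSEQ_le)
    show "(\<lambda>n. norm (x - p n)) \<longlonglongrightarrow> norm (x - l)" by (intro tendsto_intros l)
    have "(\<lambda>n. d + 1 / Suc n) \<longlonglongrightarrow> d + 0" by (intro tendsto_intros LIMSEQ_Suc[OF lim_1_over_n])
    then show "(\<lambda>n. d + 1 / Suc n) \<longlonglongrightarrow> d" by simp
    show "\<exists>N. \<forall>n\<ge>N. norm (x - p n) \<le> d + 1 / Suc n" using p less_imp_le by blast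
  qed
  ultimately show ?thesis using d_le by (meson order_trans)
qed

text \<open>If the error \<open>x - p\<close> had a nonzero component along \<open>m\<close>, moving
  \<open>p\<close> by that component would bring it strictly closer to \<open>x\<close>.\<close>

lemma nearest_point_orthogonal:
  fixes x :: "'a::complex_hilbert"
  assumes M: "csubspace M" and p: "p \<in> M" and np: "\<And>m. m \<in> M \<Longrightarrow> norm (x - p) \<le> norm (x - m)"
    and m: "m \<in> M"
  shows "cinner m (x - p) = 0"
proof (rule ccontr)
  assume nz: "cinner m (x - p) \<noteq> 0"
  then have m0: "norm m > 0" by auto
  define c where "c = cinner m (x - p) / cinner m m"
  have cnz: "norm (scaleC c m) > 0" using nz m0 by (auto simp: c_def)
  have "cinner m (x - p - scaleC c m) = 0"
    using m0 by (simp add: c_def cinner_diff_right cinner_scaleC_right)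
  then have "cinner (scaleC c m) (x - p - scaleC c m) = 0" by (simp add: cinner_scaleC_left)
  then have "(norm (x - p))\<^sup>2 = (norm (scaleC c m))\<^sup>2 + (norm (x - (p + scaleC c m)))\<^sup>2"
    using norm_add_sq[of "scaleC c m" "x - p - scaleC c m"] by (simp add: diff_diff_eq)
  moreover have "norm (x - p) \<le> norm (x - (p + scaleC c m))"
    by (rule np) (use M p m in \<open>auto simp: csubspace_def\<close>)
  then have "(norm (x - p))\<^sup>2 \<le> (norm (x - (p + scaleC c m)))\<^sup>2" by (simp add: power_mono)
  ultimately show False using cnz by (simp del: norm_scaleC)
qed

lemma orthogonal_decomposition:
  fixes x :: "'a::complex_hilbert"
  assumes "csubspace M" "closed M"
  shows "\<exists>p\<in>M. \<forall>m\<in>M. cinner m (x - p) = 0"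
  using nearest_point_exists[OF assms, of x] nearest_point_orthogonal[OF assms(1)] by blast

section \<open>Riesz representation\<close>

lemma bounded_linear_cinner_right: "bounded_linear (cinner (y::'a::complex_hilbert))"
proof (rule bounded_linear_intro[where K = "norm y"])
  show "cinner y (scaleR r x) = scaleR r (cinner y x)" for r x
    by (metis cinner_scaleC_right scaleC_of_real scaleR_conv_of_real)
  show "norm (cinner y x) \<le> norm x * norm y" for x
    using cinner_norm_le[of y x] by (simp add: mult.commute)
qed (simp add: cinner_add_right)

text \<open>A nonzero vector \<open>w\<close> orthogonal to the kernel of \<open>f\<close>
  represents \<open>f\<close> after rescaling, because every \<open>x\<close> differs from a
  multiple of \<open>w\<close> by an element of the kernel.\<close>

lemma riesz_representation:
  fixes f :: "'a::complex_hilbert \<Rightarrow> complex"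
  assumes bl: "bounded_linear f" and sc: "\<And>c x. f (scaleC c x) = c * f x"
  obtains z where "\<And>x. f x = cinner z x"
proof (cases "\<forall>x. f x = 0")
  case True
  then show ?thesis using that[of 0] by simp
next
  case False
  interpret bounded_linear f by (rule bl)
  let ?M = "{x. f x = 0}"
  have sub: "csubspace ?M" by (simp add: csubspace_def add sc)
  have cl: "closed ?M"
    by (intro closed_Collect_eq continuous_on_const linear_continuous_on bl)
  obtain x0 where x0: "f x0 \<noteq> 0" using False by blast
  from orthogonal_decomposition[OF sub cl, of x0]
  obtain p where p: "p \<in> ?M" and orth: "\<forall>m\<in>?M. cinner m (x0 - p) = 0" ..
  define w where "w = x0 - p"
  have fw: "f w \<noteq> 0" using p x0 by (simp add: w_def diff)
  then have w0: "w \<noteq> 0" using zero by metis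
  \<comment> \<open>The factor is conjugated because \<open>cinner\<close> is conjugate linear in
    its first argument.\<close>
  have "f x = cinner (scaleC (cnj (f w / cinner w w)) w) x" for x
  proof -
    have "f (x - scaleC (f x / f w) w) = 0" using fw by (simp add: diff sc)
    then have "cinner (x - scaleC (f x / f w) w) w = 0" using orth w_def by simp
    then have "cinner w (x - scaleC (f x / f w) w) = 0"
      using cinner_conj[of w "x - scaleC (f x / f w) w"] by simp
    then have "cinner w x = f x / f w * cinner w w" by (simp add: cinner_diff_right cinner_scaleC_right)
    then show ?thesis using fw w0 by (simp add: cinner_scaleC_left)
  qed
  then show ?thesis by (rule that)
qed

section \<open>Bounded operators and their adjoints\<close>

lemma bop_bounded_linear: "bop T \<Longrightarrow> bounded_linear T"
  by (simp add: bop_def)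

lemma bop_scaleC: "bop T \<Longrightarrow> T (scaleC c x) = scaleC c (T x)"
  by (simp add: bop_def)

lemma bop_add: "bop T \<Longrightarrow> T (x + y) = T x + T y"
  using bounded_linear.axioms(1) bop_bounded_linear linear_add by blast

lemma bop_diff: "bop T \<Longrightarrow> T (x - y) = T x - T y"
  using bounded_linear.axioms(1) bop_bounded_linear linear_diff by blast

lemma bop_zero: "bop T \<Longrightarrow> T 0 = 0"
  using bounded_linear.axioms(1) bop_bounded_linear linear_0 by blast

lemma bop_norm_le: "bop T \<Longrightarrow> norm (T x) \<le> onorm T * norm x"
  by (simp add: bop_bounded_linear onorm)

lemma bopI:
  fixes T :: "'a::complex_hilbert \<Rightarrow> 'a"
  assumes "\<And>x y. T (x + y) = T x + T y" "\<And>c x. T (scaleC c x) = scaleC c (T x)"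
    and "\<And>x. norm (T x) \<le> K * norm x"
  shows "bop T"
  unfolding bop_def
proof
  show "bounded_linear T"
  proof (rule bounded_linear_intro[where K = K])
    show "T (scaleR r x) = scaleR r (T x)" for r x
      by (metis assms(2) scaleC_of_real)
  qed (simp_all add: assms mult.commute)
qed (simp add: assms)

lemma bop_comp: "bop S \<Longrightarrow> bop T \<Longrightarrow> bop (S \<circ> T)"
  unfolding bop_def comp_def by (auto intro: bounded_linear_compose)

lemma bop_plus: "bop S \<Longrightarrow> bop T \<Longrightarrow> bop (\<lambda>x. S x + T x)"
  by (simp add: bop_def bounded_linear_add scaleC_add_right)

lemma bop_scale:
  assumes "bop (T :: 'a::complex_hilbert \<Rightarrow> 'a)"
  shows "bop (\<lambda>x. scaleC c (T x))"
proof (rule bopI)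
  show "norm (scaleC c (T x)) \<le> (cmod c * onorm T) * norm x" for x
    using bop_norm_le[OF assms, of x] by (simp add: mult.assoc mult_left_mono)
qed (simp_all add: bop_add[OF assms] bop_scaleC[OF assms] scaleC_add_right scaleC_scaleC mult.commute)

lemma bop_minus: "bop S \<Longrightarrow> bop T \<Longrightarrow> bop (\<lambda>x. S x - T x)"
  by (simp add: bop_def bounded_linear_sub cvs.scale_right_diff_distrib)

lemma bop_id: "bop id"
  by (simp add: bop_def bounded_linear_ident[unfolded id_def[symmetric]] id_def bounded_linear_ident)

lemma bop_funpow: "bop T \<Longrightarrow> bop (T ^^ n)"
  by (induction n) (simp_all add: bop_id bop_comp)

text \<open>This justifies the definite description in \<open>adj\<close>: Riesz gives existence,
  and a vector is determined by its inner products.\<close>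

lemma adj_cinner:
  assumes T: "bop (T :: 'a::complex_hilbert \<Rightarrow> 'a)"
  shows "cinner (T x) y = cinner x (adj T y)"
proof -
  have bl: "bounded_linear (\<lambda>x. cinner y (T x))"
    by (rule bounded_linear_compose[OF bounded_linear_cinner_right bop_bounded_linear[OF T]])
  obtain z where z: "\<And>x. cinner y (T x) = cinner z x"
    by (rule riesz_representation[OF bl]) (auto simp: bop_scaleC[OF T] cinner_scaleC_right)
  then have 1: "\<forall>x. cinner (T x) y = cinner x z" by (metis cinner_conj)
  have "\<exists>!z. \<forall>x. cinner (T x) y = cinner x z"
  proof (rule ex_ex1I)
    show "\<exists>z. \<forall>x. cinner (T x) y = cinner x z" using 1 by blast
    show "z = z'" if "\<forall>x. cinner (T x) y = cinner x z" "\<forall>x. cinner (T x) y = cinner x z'" for z z'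
      by (rule cinner_ext) (metis that cinner_conj)
  qed
  from theI'[OF this] show ?thesis unfolding adj_def by blast
qed

lemma adj_cinner': "bop T \<Longrightarrow> cinner y (T x) = cinner (adj T y) (x::'a::complex_hilbert)"
  by (metis adj_cinner cinner_conj)

lemma norm_le_of_cinner:
  assumes "\<And>x. cmod (cinner x y) \<le> K * norm (x::'a::complex_hilbert)" "0 \<le> K"
  shows "norm y \<le> K"
proof (cases "y = 0")
  case False
  have "cmod (cinner y y) = (norm y)\<^sup>2" by (simp add: cinner_self norm_power)
  then have "norm y * norm y \<le> K * norm y" using assms(1)[of y] by (simp add: power2_eq_square)
  then show ?thesis using False by simp
qed (use assms in simp)

lemma bop_adj:
  assumes T: "bop (T :: 'a::complex_hilbert \<Rightarrow> 'a)"
  shows "bop (adj T)"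
proof (rule bopI)
  show "adj T (x + y) = adj T x + adj T y" for x y
    by (rule cinner_ext) (simp add: adj_cinner'[OF T, symmetric] cinner_add_left)
  show "adj T (scaleC c x) = scaleC c (adj T x)" for c x
    by (rule cinner_ext) (simp add: adj_cinner'[OF T, symmetric] cinner_scaleC_left)
  show "norm (adj T x) \<le> onorm T * norm x" for x
  proof (rule norm_le_of_cinner)
    fix y
    have "cmod (cinner y (adj T x)) \<le> norm (T y) * norm x"
      using cinner_norm_le by (simp add: adj_cinner[OF T, symmetric])
    also have "\<dots> \<le> (onorm T * norm y) * norm x"
      by (intro mult_right_mono bop_norm_le T) simp
    finally show "cmod (cinner y (adj T x)) \<le> onorm T * norm x * norm y" by (simp add: mult_ac)
  qed (simp add: onorm_pos_le bop_bounded_linear[OF T])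
qed

section \<open>The open mapping theorem\<close>

text \<open>The Baire half of the open mapping theorem: linear control of the preimage, at the price
  of an error of half the norm.\<close>

lemma surj_approximate_preimage:
  fixes f :: "'a::banach \<Rightarrow> 'b::banach"
  assumes bl: "bounded_linear f" and sj: "surj f"
  obtains M where "M \<ge> 0" "\<And>y. \<exists>x. norm x \<le> M * norm y \<and> norm (y - f x) \<le> norm y / 2"
proof -
  interpret bounded_linear f by (rule bl)
  define C where "C n = closure (f ` ball 0 (real (Suc n)))" for n
  have un: "\<Union>(range C) = UNIV"
  proof -
    have "y \<in> \<Union>(range C)" for y
    proof -
      obtain x where x: "y = f x" using sj by blast
      obtain n where "norm x < real n" using reals_Archimedean2 by blast
      then have "y \<in> f ` ball 0 (real (Suc n))" using x by auto
      then have "y \<in> C n" unfolding C_def by (rule subsetD[OF closure_subset])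
      then show ?thesis by (intro UnionI[of "C n"] rangeI)
    qed
    then show ?thesis by blast
  qed
  \<comment> \<open>The closed sets \<open>C n\<close> cover the complete space, so by Baire they
    cannot all have empty interior.\<close>
  have "\<exists>n. interior (C n) \<noteq> {}"
  proof (rule ccontr)
    assume "\<not> ?thesis"
    then have "Met_TC.mtopology interior_of \<Union>(range C) = ({} :: 'b set)"
      by (intro Met_TC.metric_Baire_category_alt) (auto simp: C_def complete_UNIV)
    then show False by (simp add: un)
  qed
  then obtain n y0 where "y0 \<in> interior (C n)" by blast
  then obtain r where r: "r > 0" "ball y0 r \<subseteq> C n"
    by (metis mem_interior)
  \<comment> \<open>The ball found by Baire is centred at \<open>y0\<close>, not at 0. Writing
    \<open>y\<close> as \<open>(y0 + y) - y0\<close> and approximating both points recentres it and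
    doubles the bound on the preimage.\<close>
  have approx: "\<exists>x. norm x \<le> 2 * Suc n \<and> norm (y - f x) < e" if y: "norm y < r" and e: "e > 0" for y e
  proof -
    have "y0 \<in> C n" "y0 + y \<in> C n" using r y by (auto simp: subset_iff dist_norm)
    moreover have "\<exists>a. norm a < Suc n \<and> dist (f a) z < e/2" if z: "z \<in> C n" for z
    proof -
      from z obtain w where w: "w \<in> f ` ball 0 (real (Suc n))" "dist w z < e/2"
        unfolding C_def closure_approachable using half_gt_zero[OF e] by blast
      from w(1) obtain a where "w = f a" "norm a < Suc n" by (elim imageE) simp
      with w(2) show ?thesis by blast
    qed
    ultimately obtain a b where a: "norm a < Suc n" "dist (f a) y0 < e/2"
      and b: "norm b < Suc n" "dist (f b) (y0 + y) < e/2" by meson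
    have "y - f (b - a) = (f a - y0) - (f b - (y0 + y))" by (simp add: diff)
    then have "norm (y - f (b - a)) \<le> norm (f a - y0) + norm (f b - (y0 + y))"
      by (simp only: norm_triangle_ineq4)
    then have "norm (y - f (b - a)) < e" using a(2) b(2) by (simp add: dist_norm)
    moreover have "norm (b - a) \<le> 2 * Suc n" using norm_triangle_ineq4[of b a] a(1) b(1) by simp
    ultimately show ?thesis by blast
  qed
  \<comment> \<open>Scale \<open>y\<close> to norm \<open>r / 2\<close> and approximate it within
    \<open>r / 4\<close>, which is half its norm. Undoing the scaling multiplies
    \<open>2 * Suc n\<close> by \<open>2 * norm y / r\<close>, which gives
    \<open>M * norm y\<close>.\<close>
  define M where "M = 4 * real (Suc n) / r"
  have "\<exists>x. norm x \<le> M * norm y \<and> norm (y - f x) \<le> norm y / 2" for y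
  proof (cases "y = 0")
    case True
    then show ?thesis by (intro exI[of _ 0]) (simp add: zero)
  next
    case False
    define s where "s = r / (2 * norm y)"
    have s: "s > 0" using False r by (simp add: s_def)
    have sy: "norm (s *\<^sub>R y) = r / 2" using False r(1) by (simp add: s_def)
    obtain x where x: "norm x \<le> 2 * Suc n" "norm (s *\<^sub>R y - f x) < r / 4"
      using approx[of "s *\<^sub>R y" "r / 4"] sy r(1) by auto
    have "norm (inverse s *\<^sub>R x) \<le> M * norm y"
    proof -
      have "norm (inverse s *\<^sub>R x) = norm x / s" using s by (simp add: divide_inverse_commute)
      also have "\<dots> \<le> 2 * Suc n / s" using x(1) s by (simp add: divide_right_mono)
      also have "\<dots> = M * norm y" using r(1) False by (simp add: s_def M_def)
      finally show ?thesis .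
    qed
    moreover have "y - f (inverse s *\<^sub>R x) = inverse s *\<^sub>R (s *\<^sub>R y - f x)"
      using s by (simp add: scaleR scaleR_diff_right)
    then have "norm (y - f (inverse s *\<^sub>R x)) = norm (s *\<^sub>R y - f x) / s"
      using s by (simp add: divide_inverse_commute)
    then have "norm (y - f (inverse s *\<^sub>R x)) \<le> (r / 4) / s"
      using divide_right_mono[OF less_imp_le[OF x(2)], of s] s by simp
    then have "norm (y - f (inverse s *\<^sub>R x)) \<le> norm y / 2"
      using r(1) False by (simp add: s_def)
    ultimately show ?thesis by blast
  qed
  moreover have "M \<ge> 0" using r by (simp add: M_def)
  ultimately show ?thesis using that by blast
qed

text \<open>Successive correction: the residuals halve each time, so the corrections form an
  absolutely convergent series whose sum is an exact preimage. The geometric sum doubles the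
  constant.\<close>

theorem surj_bounded_preimage:
  fixes f :: "'a::banach \<Rightarrow> 'b::banach"
  assumes bl: "bounded_linear f" and sj: "surj f"
  obtains K where "\<And>y. \<exists>x. f x = y \<and> norm x \<le> K * norm y"
proof -
  interpret bounded_linear f by (rule bl)
  obtain M where M: "M \<ge> 0" and ex: "\<And>y. \<exists>x. norm x \<le> M * norm y \<and> norm (y - f x) \<le> norm y / 2"
    using surj_approximate_preimage[OF assms] by blast
  from ex obtain g where g1: "\<And>y. norm (g y) \<le> M * norm y" and g2: "\<And>y. norm (y - f (g y)) \<le> norm y / 2"
    by metis
  have "\<exists>x. f x = y \<and> norm x \<le> (2 * M) * norm y" for y
  proof -
    \<comment> \<open>\<open>h k\<close> is the residual after \<open>k\<close> corrections, so
      \<open>f (g (h k))\<close> is the difference \<open>h k - h (Suc k)\<close> and the series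
      telescopes to \<open>y\<close>.\<close>
    define h where "h k = ((\<lambda>z. z - f (g z)) ^^ k) y" for k
    have h0: "h 0 = y" and hS: "h (Suc k) = h k - f (g (h k))" for k by (simp_all add: h_def)
    have hn: "norm (h k) \<le> norm y * (1/2) ^ k" for k
    proof (induction k)
      case (Suc k)
      then show ?case using g2[of "h k"] by (simp add: hS)
    qed (simp add: h0)
    have bnd: "norm (g (h k)) \<le> M * norm y * (1/2) ^ k" for k
      using g1[of "h k"] mult_left_mono[OF hn[of k] M] by (simp add: mult.assoc)
    have gs: "(\<lambda>k. M * norm y * (1/2) ^ k) sums (M * norm y * 2)"
      using sums_mult[OF geometric_sums[of "1/2::real"], of "M * norm y"] by simp
    have sn: "summable (\<lambda>k. norm (g (h k)))"
      by (rule summable_comparison_test'[OF sums_summable[OF gs]]) (simp add: bnd)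
    then have sm: "summable (\<lambda>k. g (h k))" by (rule summable_norm_cancel)
    have "(\<lambda>k. norm y * (1/2) ^ k) \<longlonglongrightarrow> 0"
      by (intro tendsto_mult_right_zero LIMSEQ_realpow_zero) simp_all
    with always_eventually[OF allI[OF hn]] have "h \<longlonglongrightarrow> 0" by (rule Lim_null_comparison)
    then have "(\<lambda>k. h k - h (Suc k)) sums (h 0 - 0)" by (rule telescope_sums')
    then have "(\<lambda>k. f (g (h k))) sums y" by (simp add: hS h0)
    moreover have "(\<lambda>k. f (g (h k))) sums f (\<Sum>k. g (h k))"
      by (rule sums) (simp add: summable_sums sm)
    ultimately have "f (\<Sum>k. g (h k)) = y" by (rule sums_unique2[symmetric])
    moreover have "norm (\<Sum>k. g (h k)) \<le> (2 * M) * norm y"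
    proof -
      have "norm (\<Sum>k. g (h k)) \<le> (\<Sum>k. norm (g (h k)))" by (rule summable_norm[OF sn])
      also have "\<dots> \<le> (\<Sum>k. M * norm y * (1/2) ^ k)"
        by (rule suminf_le[OF bnd sn sums_summable[OF gs]])
      also have "\<dots> = M * norm y * 2" using gs sums_unique by metis
      finally show ?thesis by simp
    qed
    ultimately show ?thesis by blast
  qed
  then show ?thesis by (rule that)
qed

section \<open>Rank-one operators and spatial isomorphisms\<close>

text \<open>Bounded inverse theorem: by injectivity the norm-controlled preimage is the value of
  \<open>inv W\<close>.\<close>

lemma bop_inv:
  fixes W :: "'a::complex_hilbert \<Rightarrow> 'a"
  assumes W: "bop W" and bij: "bij W"
  shows "bop (inv W)"
proof -
  obtain M where M: "\<And>h. \<exists>g. W g = h \<and> norm g \<le> M * norm h"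
    using surj_bounded_preimage[OF bop_bounded_linear[OF W] bij_is_surj[OF bij]] by blast
  have WI: "W (inv W h) = h" for h using bij by (simp add: bij_is_surj surj_f_inv_f)
  have IW: "inv W (W g) = g" for g using bij by (simp add: bij_is_inj)
  have inj: "g = h" if "W g = W h" for g h using that IW by metis
  show ?thesis
  proof (rule bopI[where K = M])
    show "inv W (x + y) = inv W x + inv W y" for x y by (rule inj) (simp add: WI bop_add[OF W])
    show "inv W (scaleC c x) = scaleC c (inv W x)" for c x by (rule inj) (simp add: WI bop_scaleC[OF W])
    show "norm (inv W x) \<le> M * norm x" for x using M[of x] IW by metis
  qed
qed

section \<open>Rank-one operators\<close>

definition rank_one :: "'a::complex_hilbert \<Rightarrow> 'a \<Rightarrow> 'a \<Rightarrow> 'a" where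
  "rank_one u g = (\<lambda>x. scaleC (cinner g x) u)"

lemma comp_rank_one: "bop A \<Longrightarrow> A \<circ> rank_one u g = rank_one (A u) g"
  by (simp add: rank_one_def fun_eq_iff bop_scaleC)

lemma rank_one_comp: "bop A \<Longrightarrow> rank_one u g \<circ> A = rank_one u (adj A g)"
  by (simp add: rank_one_def fun_eq_iff adj_cinner')

lemma rank_one_add_right: "rank_one u (g + h) = (\<lambda>x. rank_one u g x + rank_one u h x)"
  by (simp add: rank_one_def cinner_add_left scaleC_add_left)

lemma rank_one_scaleC_right: "rank_one u (scaleC c g) = (\<lambda>x. scaleC (cnj c) (rank_one u g x))"
  by (simp add: rank_one_def cinner_scaleC_left scaleC_scaleC)

lemma rank_one_zero_right: "rank_one u 0 = (\<lambda>x. 0)"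
  by (simp add: rank_one_def)

lemma rank_one_inject:
  assumes "u \<noteq> 0"
  shows "rank_one u g = rank_one u h \<longleftrightarrow> g = h"
proof
  assume eq: "rank_one u g = rank_one u h"
  show "g = h"
  proof (rule cinner_ext)
    fix x
    have "scaleC (cinner g x) u = scaleC (cinner h x) u" using fun_cong[OF eq, of x] by (simp add: rank_one_def)
    then show "cinner g x = cinner h x" using assms by simp
  qed
qed simp

lemma norm_rank_one_le: "norm (rank_one u g x) \<le> (norm u * norm g) * norm x"
  using mult_right_mono[OF cinner_norm_le[of g x], of "norm u"] by (simp add: rank_one_def mult_ac)

lemma bop_rank_one: "bop (rank_one u g)"
proof (rule bopI)
  show "norm (rank_one u g x) \<le> (norm u * norm g) * norm x" for x by (rule norm_rank_one_le)
qed (simp_all add: rank_one_def cinner_add_right scaleC_add_left cinner_scaleC_right scaleC_scaleC)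

lemma onorm_rank_one: "onorm (rank_one u g) = norm u * norm g"
proof (rule antisym)
  show "onorm (rank_one u g) \<le> norm u * norm g"
    by (rule onorm_bound) (simp_all add: norm_rank_one_le)
  show "norm u * norm g \<le> onorm (rank_one u g)"
  proof (cases "g = 0")
    case True
    then show ?thesis by (simp add: onorm_pos_le bop_bounded_linear[OF bop_rank_one])
  next
    case False
    have "norm (rank_one u g g) \<le> onorm (rank_one u g) * norm g"
      by (rule bop_norm_le[OF bop_rank_one])
    moreover have "norm (rank_one u g g) = (norm u * norm g) * norm g"
      by (simp add: rank_one_def cinner_self norm_mult power2_eq_square)
    ultimately show ?thesis using False by simp
  qed
qed

lemma range_line_operator:
  assumes A: "bop A" and v: "v \<noteq> 0" and range: "\<And>x. \<exists>c. A x = scaleC c v"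
  obtains h where "A = rank_one v h"
proof -
  \<comment> \<open>Normalised so that \<open>cinner a v = 1\<close>: pairing \<open>A x\<close>
    with \<open>a\<close> reads off its coefficient along \<open>v\<close>, and the adjoint moves
    \<open>A\<close> onto \<open>a\<close>.\<close>
  define a where "a = scaleC (inverse (cinner v v)) v"
  have "cinner v v \<noteq> 0" using v by simp
  have Ax: "A x = scaleC (cinner (adj A a) x) v" for x
  proof -
    obtain c where c: "A x = scaleC c v" using range by blast
    have "cinner (adj A a) x = cinner a (A x)" by (rule adj_cinner'[OF A, symmetric])
    also have "\<dots> = c" using v cinner_conj[of v v] by (simp add: c a_def cinner_scaleC_left cinner_scaleC_right)
    finally show ?thesis by (simp add: c)
  qed
  then show ?thesis by (intro that[of "adj A a"]) (simp add: rank_one_def fun_eq_iff)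
qed

text \<open>The algebraic core, stated for any two composition-closed families of operators that
  contain all \<open>rank_one e g\<close> for one fixed unit vector \<open>e\<close> each.\<close>

theorem spatial_if_rank_one:
  fixes \<phi> :: "('a::complex_hilbert \<Rightarrow> 'a) \<Rightarrow> ('a \<Rightarrow> 'a)"
  assumes bop1: "\<And>A. A \<in> \<A> \<Longrightarrow> bop A" and comp1: "\<And>A B. A \<in> \<A> \<Longrightarrow> B \<in> \<A> \<Longrightarrow> A \<circ> B \<in> \<A>"
    and rk1: "\<And>g. rank_one e1 g \<in> \<A>" and e1: "norm e1 = 1"
    and bop2: "\<And>A. A \<in> \<B> \<Longrightarrow> bop A" and comp2: "\<And>A B. A \<in> \<B> \<Longrightarrow> B \<in> \<B> \<Longrightarrow> A \<circ> B \<in> \<B>"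
    and rk2: "\<And>g. rank_one e2 g \<in> \<B>" and e2: "norm e2 = 1"
    and iso: "bounded_alg_iso \<phi> \<A> \<B>"
  shows "\<exists>V. invertible_op V \<and> (\<forall>A\<in>\<A>. \<phi> A = V \<circ> A \<circ> inv V)"
proof -
  have e1e1: "cinner e1 e1 = 1" and e1_nz: "e1 \<noteq> 0" using e1 by (auto simp: cinner_self)
  have e2_nz: "e2 \<noteq> 0" using e2 by auto
  have bij: "bij_betw \<phi> \<A> \<B>"
    and add: "\<And>A B. A \<in> \<A> \<Longrightarrow> B \<in> \<A> \<Longrightarrow> \<phi> (\<lambda>x. A x + B x) = (\<lambda>x. \<phi> A x + \<phi> B x)"
    and scale: "\<And>A c. A \<in> \<A> \<Longrightarrow> \<phi> (\<lambda>x. scaleC c (A x)) = (\<lambda>x. scaleC c (\<phi> A x))"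
    and mult: "\<And>A B. A \<in> \<A> \<Longrightarrow> B \<in> \<A> \<Longrightarrow> \<phi> (A \<circ> B) = \<phi> A \<circ> \<phi> B"
    using iso unfolding bounded_alg_iso_def by blast+
  obtain K where K: "\<And>A. A \<in> \<A> \<Longrightarrow> onorm (\<phi> A) \<le> K * onorm A"
    using iso unfolding bounded_alg_iso_def by blast
  have mem: "\<phi> A \<in> \<B>" if "A \<in> \<A>" for A using bij that by (rule bij_betw_apply)
  have inj: "A = B" if "\<phi> A = \<phi> B" "A \<in> \<A>" "B \<in> \<A>" for A B
    using bij_betw_imp_inj_on[OF bij] that by (rule inj_onD)
  have surj: "\<exists>A\<in>\<A>. B = \<phi> A" if "B \<in> \<B>" for B
    using bij_betw_imp_surj_on[OF bij] that by blast
  have zero1: "(\<lambda>x. 0) \<in> \<A>" using rk1[of 0] by (simp add: rank_one_zero_right)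
  have phi0: "\<phi> (\<lambda>x. 0) = (\<lambda>x. 0)"
    using scale[OF zero1, of 0] by simp
  define p where "p = rank_one e1 e1"
  define q where "q = \<phi> p"
  have p: "p \<in> \<A>" unfolding p_def by (rule rk1)
  have q: "q \<in> \<B>" unfolding q_def by (rule mem[OF p])
  have p_rk: "p \<circ> rank_one e1 g = rank_one e1 g" for g
    by (simp add: p_def comp_rank_one[OF bop_rank_one]) (simp add: rank_one_def e1e1 scaleC_one)
  have pp: "p \<circ> p = p" using p_rk[of e1] by (simp add: p_def)
  have qq: "q \<circ> q = q" unfolding q_def by (simp add: mult[OF p p, symmetric] pp)

  \<comment> \<open>Otherwise \<open>p \<circ> \<A> \<circ> r = 0\<close> for the preimage \<open>r\<close> of \<open>rank_one e2 e2\<close>, although the right ideal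
    \<open>p \<circ> \<A>\<close> contains every \<open>rank_one e1 g\<close> and so separates points.\<close>
  have "\<exists>B\<in>\<B>. q (B e2) \<noteq> 0"
  proof (rule ccontr)
    assume "\<not> ?thesis"
    then have none: "q (B e2) = 0" if "B \<in> \<B>" for B using that by blast
    obtain r where r: "r \<in> \<A>" "rank_one e2 e2 = \<phi> r" using surj[OF rk2] by blast
    have "rank_one e1 g \<circ> r = (\<lambda>x. 0)" for g
    proof (rule inj)
      have "\<phi> (rank_one e1 g \<circ> r) = \<phi> (p \<circ> (rank_one e1 g \<circ> r))"
        by (simp add: p_rk o_assoc)
      also have "\<dots> = q \<circ> (\<phi> (rank_one e1 g) \<circ> rank_one e2 e2)"
        by (simp add: mult[OF p comp1[OF rk1 r(1)]] mult[OF rk1 r(1)] r(2) q_def)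
      also have "\<dots> = (\<lambda>x. 0)"
        by (simp add: comp_rank_one[OF bop2[OF mem[OF rk1]]] comp_rank_one[OF bop2[OF q]] none[OF mem[OF rk1]])
          (simp add: rank_one_def)
      finally show "\<phi> (rank_one e1 g \<circ> r) = \<phi> (\<lambda>x. 0)" by (simp add: phi0)
    qed (use comp1 rk1 r zero1 in auto)
    then have "cinner g (r x) = 0" for g x
      using e1_nz by (simp add: rank_one_def fun_eq_iff)
    then have "r x = 0" for x using cinner_eq_zero_iff by blast
    then have "r = (\<lambda>x. 0)" by blast
    then have "rank_one e2 e2 e2 = 0" using r(2) phi0 by simp
    then show False using e2_nz by (simp add: rank_one_def)
  qed
  then obtain B where B: "B \<in> \<B>" "q (B e2) \<noteq> 0" by blast
  define v where "v = q (B e2)"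
  have v: "v \<noteq> 0" using B by (simp add: v_def)
  have qv: "q v = v" using fun_cong[OF qq, of "B e2"] by (simp add: v_def)
  \<comment> \<open>Multiplying \<open>rank_one e2 h\<close> on the left by
    \<open>q \<circ> B\<close> replaces \<open>e2\<close> by \<open>v\<close>, a vector fixed by
    \<open>q\<close>.\<close>
  have rkv: "rank_one v h \<in> \<B>" for h
    using comp2[OF comp2[OF q B(1)] rk2[of h]]
    by (simp add: comp_rank_one[OF bop_comp[OF bop2[OF q] bop2[OF B(1)]]] v_def)

  \<comment> \<open>\<open>p \<circ> A \<circ> p\<close> is always a multiple of \<open>p\<close>; transporting this to \<open>q\<close> and testing it on
    \<open>rank_one v v\<close> shows that \<open>q\<close> has rank one.\<close>
  have q_range: "\<exists>c. q x = scaleC c v" for x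
  proof -
    obtain A where A: "A \<in> \<A>" "rank_one v v = \<phi> A" using surj[OF rkv] by blast
    define c where "c = cinner e1 (A e1)"
    have pAp: "p \<circ> (A \<circ> p) = (\<lambda>x. scaleC c (p x))"
      by (simp add: p_def rank_one_def fun_eq_iff c_def bop_scaleC[OF bop1[OF A(1)]] cinner_scaleC_right scaleC_scaleC)
    have "q \<circ> (rank_one v v \<circ> q) = \<phi> (p \<circ> (A \<circ> p))"
      by (simp add: mult[OF p comp1[OF A(1) p]] mult[OF A(1) p] A(2) q_def)
    also have "\<dots> = (\<lambda>x. scaleC c (q x))"
      by (simp add: pAp scale[OF p] q_def)
    finally have "(q \<circ> (rank_one v v \<circ> q)) x = scaleC c (q x)" for x by (rule fun_cong)
    then have *: "scaleC (cinner v (q x)) v = scaleC c (q x)" for x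
      by (simp add: rank_one_def bop_scaleC[OF bop2[OF q]] qv)
    \<comment> \<open>At \<open>x = v\<close> the left side of the identity is
      \<open>cinner v v\<close> times \<open>v\<close>, which is nonzero.\<close>
    have "c \<noteq> 0" using *[of v] v by (auto simp: qv)
    then have "q x = scaleC (inverse c * cinner v (q x)) v"
      using arg_cong[OF *[of x], of "scaleC (inverse c)"] by (simp add: scaleC_scaleC scaleC_one)
    then show ?thesis by blast
  qed

  \<comment> \<open>Left multiplication by \<open>p\<close> fixes \<open>rank_one e1 g\<close>, so
    left multiplication by \<open>q\<close> fixes its image, whose range therefore lies in the line
    of \<open>v\<close>.\<close>
  have "\<exists>h. \<phi> (rank_one e1 g) = rank_one v h" for g
  proof -
    have eq: "\<phi> (rank_one e1 g) = q \<circ> \<phi> (rank_one e1 g)"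
      by (simp add: q_def mult[OF p rk1, symmetric] p_rk)
    have "\<exists>c. \<phi> (rank_one e1 g) x = scaleC c v" for x
      by (subst eq) (simp only: o_apply q_range)
    then obtain h where "\<phi> (rank_one e1 g) = rank_one v h"
      by (rule range_line_operator[OF bop2[OF mem[OF rk1]] v])
    then show ?thesis by (rule exI)
  qed
  then obtain W where W: "\<And>g. \<phi> (rank_one e1 g) = rank_one v (W g)" by metis
  have W_add: "W (g + h) = W g + W h" for g h
  proof -
    have "rank_one v (W (g + h)) = rank_one v (W g + W h)"
      by (simp add: W[symmetric] rank_one_add_right add[OF rk1 rk1])
    then show ?thesis by (simp add: rank_one_inject[OF v])
  qed
  \<comment> \<open>\<open>rank_one\<close> is conjugate linear in its second vector on both sides
    of \<open>\<phi>\<close>; the two conjugations cancel and \<open>W\<close> is complex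
    linear.\<close>
  have W_scaleC: "W (scaleC c g) = scaleC c (W g)" for c g
  proof -
    have "rank_one v (W (scaleC c g)) = \<phi> (\<lambda>x. scaleC (cnj c) (rank_one e1 g x))"
      by (simp only: W[symmetric] rank_one_scaleC_right)
    also have "\<dots> = rank_one v (scaleC c (W g))"
      by (simp only: scale[OF rk1] W rank_one_scaleC_right)
    finally have "rank_one v (W (scaleC c g)) = rank_one v (scaleC c (W g))" .
    then show ?thesis by (simp add: rank_one_inject[OF v])
  qed
  have W_norm: "norm (W g) \<le> (K / norm v) * norm g" for g
    using K[OF rk1, of g] v by (simp add: W onorm_rank_one e1 field_simps)
  have W_bop: "bop W" by (rule bopI[OF W_add W_scaleC W_norm])
  have W_inj: "g = h" if "W g = W h" for g h
    using inj[OF _ rk1 rk1, of g h] that by (simp add: W rank_one_inject[OF e1_nz])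
  \<comment> \<open>Let \<open>A\<close> be the preimage of \<open>rank_one v h\<close>. Since
    \<open>q v = v\<close>, replacing \<open>A\<close> by \<open>p \<circ> A\<close> leaves the
    image unchanged, and \<open>p \<circ> A\<close> is
    \<open>rank_one e1 (adj A e1)\<close>.\<close>
  have W_surj: "\<exists>g. h = W g" for h
  proof -
    obtain A where A: "A \<in> \<A>" "rank_one v h = \<phi> A" using surj[OF rkv] by blast
    have "\<phi> (p \<circ> A) = \<phi> A"
      by (simp add: mult[OF p A(1)] A(2)[symmetric] q_def[symmetric] comp_rank_one[OF bop2[OF q]] qv)
    then have "rank_one v h = \<phi> (rank_one e1 (adj A e1))"
      by (simp only: A(2) p_def rank_one_comp[OF bop1[OF A(1)]])
    then have "rank_one v h = rank_one v (W (adj A e1))" by (simp only: W)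
    then show ?thesis by (auto simp: rank_one_inject[OF v])
  qed
  have W_bij: "bij W" using W_inj W_surj by (auto simp: bij_def inj_def surj_def)
  have WI: "W (inv W h) = h" for h using W_bij by (simp add: bij_is_surj surj_f_inv_f)
  have IW: "inv W (W g) = g" for g using W_bij by (simp add: bij_is_inj)
  have WI_bop: "bop (inv W)" by (rule bop_inv[OF W_bop W_bij])

  define V where "V = adj (inv W)"
  define U where "U = adj W"
  have V_bop: "bop V" and U_bop: "bop U" by (simp_all add: V_def U_def bop_adj W_bop WI_bop)
  \<comment> \<open>This duality characterizes \<open>V\<close>, since the vectors
    \<open>W g\<close> exhaust the space.\<close>
  have WV: "cinner (W g) (V x) = cinner g x" for g x
    by (simp add: V_def adj_cinner[OF WI_bop, symmetric] IW)
  have W_ext: "x = y" if "\<And>g. cinner (W g) x = cinner (W g) y" for x y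
  proof (rule cinner_ext)
    show "cinner x h = cinner y h" for h using that[of "inv W h"] cinner_conj[of _ h] by (simp add: WI)
  qed
  have UV: "U (V x) = x" for x
  proof (rule cinner_ext)
    show "cinner (U (V x)) g = cinner x g" for g
      using WV[of g x] cinner_conj[of _ g] by (simp add: U_def adj_cinner[OF W_bop, symmetric])
  qed
  have VU: "V (U x) = x" for x
    by (rule W_ext) (simp add: WV U_def adj_cinner[OF W_bop, symmetric])
  \<comment> \<open>Applying \<open>\<phi>\<close> to
    \<open>rank_one e1 g \<circ> A = rank_one e1 (adj A g)\<close> shows that pairing
    \<open>W g\<close> with \<open>\<phi> A x\<close> equals pairing \<open>W (adj A g)\<close> with
    \<open>x\<close>. Writing \<open>x\<close> as \<open>V (U x)\<close> lets the duality of
    \<open>W\<close> and \<open>V\<close> remove \<open>W\<close>.\<close>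
  have "\<phi> A = V \<circ> A \<circ> U" if A: "A \<in> \<A>" for A
  proof
    fix x
    show "\<phi> A x = (V \<circ> A \<circ> U) x"
    proof (rule W_ext)
      fix g
      have "rank_one v (W g) \<circ> \<phi> A = \<phi> (rank_one e1 g \<circ> A)" by (simp add: mult[OF rk1 A] W)
      also have "\<dots> = rank_one v (W (adj A g))" by (simp add: rank_one_comp[OF bop1[OF A]] W)
      finally have "cinner (W g) (\<phi> A x) = cinner (W (adj A g)) x"
        using v by (simp add: rank_one_def fun_eq_iff)
      also have "\<dots> = cinner (W (adj A g)) (V (U x))" by (simp add: VU)
      also have "\<dots> = cinner (W g) ((V \<circ> A \<circ> U) x)"
        by (simp add: WV adj_cinner'[OF bop1[OF A]])
      finally show "cinner (W g) (\<phi> A x) = cinner (W g) ((V \<circ> A \<circ> U) x)" .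
    qed
  qed
  moreover have "V \<circ> U = id" "U \<circ> V = id" by (simp_all add: fun_eq_iff UV VU)
  moreover from this have "inv V = U" by (intro inv_unique_comp)
  ultimately show ?thesis using V_bop U_bop unfolding invertible_op_def by blast
qed

section \<open>The algebra of a left invertible operator\<close>

lemma one_dimensional_kernel:
  fixes T :: "'a::complex_hilbert \<Rightarrow> 'a"
  assumes T: "bop T" and dim: "cdim (kernel T) = 1"
  obtains e where "norm e = 1" "T e = 0" "\<And>x. T x = 0 \<Longrightarrow> \<exists>c. x = scaleC c e"
proof -
  have sub: "cvs.subspace (kernel T)"
    by (rule cvs.subspaceI) (simp_all add: kernel_def bop_zero[OF T] bop_add[OF T] bop_scaleC[OF T])
  obtain B where B: "B \<subseteq> kernel T" "cvs.independent B" "kernel T \<subseteq> cvs.span B" "card B = cvs.dim (kernel T)"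
    by (rule cvs.basis_exists)
  \<comment> \<open>An infinite set has \<open>card\<close> 0, so the value 1 really yields a
    singleton basis.\<close>
  have "card B = 1" using B(4) dim unfolding cdim_def by simp
  then obtain b where b: "B = {b}" by (rule card_1_singletonE)
  have b0: "b \<noteq> 0" using B(2) b cvs.dependent_zero by blast
  define e where "e = scaleC (of_real (inverse (norm b))) b"
  have "norm e = 1" using b0 by (simp add: e_def norm_inverse)
  moreover have "T e = 0" using B(1) b by (simp add: e_def bop_scaleC[OF T] kernel_def)
  moreover have "\<exists>c. x = scaleC c e" if "T x = 0" for x
  proof -
    have "x \<in> cvs.span {b}" using B(3) b that by (auto simp: kernel_def)
    then obtain k where k: "x = scaleC k b" by (auto simp: cvs.span_singleton)
    have "x = scaleC (k * of_real (norm b)) e" using b0 by (simp add: k e_def scaleC_scaleC)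
    then show ?thesis by blast
  qed
  ultimately show ?thesis by (rule that)
qed

text \<open>A left inverse forces the kernel of \<open>T\<close> to be trivial, so the whole index
  comes from the kernel of \<open>adj T\<close>.\<close>

lemma index_minus_one_cokernel:
  fixes T :: "'a::complex_hilbert \<Rightarrow> 'a"
  assumes li: "left_invertible T" and ind: "fredholm_index T = -1"
  shows "cdim (kernel (adj T)) = 1"
proof -
  obtain S where T: "bop T" and S: "S \<circ> T = id" "bop S" using li by (auto simp: left_invertible_def)
  have "kernel T = {0}"
  proof -
    have "x = 0" if "T x = 0" for x
      using fun_cong[OF S(1), of x] that bop_zero[OF S(2)] by simp
    then show ?thesis by (auto simp: kernel_def bop_zero[OF T])
  qed
  moreover have "cvs.dim {0 :: 'a} = 0"
    using cvs.dim_eq_card[of "{}" "{0::'a}"] by (simp add: cvs.independent_empty)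
  ultimately have "cdim (kernel T) = 0" unfolding cdim_def by simp
  then show ?thesis using ind unfolding fredholm_index_def by linarith
qed

text \<open>Injectivity: \<open>adj T (T x) = 0\<close> forces \<open>norm (T x) = 0\<close>.
  Surjectivity: \<open>adj T\<close> is onto because \<open>adj S\<close> is a right inverse of it,
  and its values are already attained on the closed range of \<open>T\<close>.\<close>

lemma gram_bij:
  fixes T :: "'a::complex_hilbert \<Rightarrow> 'a"
  assumes li: "left_invertible T" and cl: "closed (range T)"
  shows "bij (adj T \<circ> T)"
proof -
  obtain S where T: "bop T" and S: "\<And>x. S (T x) = x" "bop S"
    using li by (auto simp: left_invertible_def fun_eq_iff)
  note T' = bop_adj[OF T]
  have "x = y" if "adj T (T x) = adj T (T y)" for x y
  proof -
    have "cinner (T (x - y)) (T (x - y)) = cinner (x - y) (adj T (T x) - adj T (T y))"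
      by (simp only: adj_cinner[OF T] bop_diff[OF T, symmetric] bop_diff[OF T', symmetric])
    then have "T x = T y" using that by (simp add: bop_diff[OF T])
    then show ?thesis using S(1) by metis
  qed
  moreover have "\<exists>x. adj T (T x) = y" for y
  proof -
    define z where "z = adj S y"
    have z: "adj T z = y"
      by (rule cinner_ext) (simp add: z_def adj_cinner'[OF T, symmetric] adj_cinner'[OF S(2), symmetric] S(1))
    have "csubspace (range T)"
      unfolding csubspace_def
    proof (intro conjI ballI allI)
      show "0 \<in> range T" using bop_zero[OF T] by (metis rangeI)
      show "a + b \<in> range T" if "a \<in> range T" "b \<in> range T" for a b
        using that by (auto simp: bop_add[OF T, symmetric])
      show "scaleC c a \<in> range T" if "a \<in> range T" for c a
        using that by (auto simp: bop_scaleC[OF T, symmetric])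
    qed
    \<comment> \<open>Projecting \<open>z\<close> onto the range of \<open>T\<close> changes it by a
      vector orthogonal to that range, which \<open>adj T\<close> annihilates.\<close>
    then obtain x where x: "\<forall>m. cinner (T m) (z - T x) = 0"
      using orthogonal_decomposition[OF _ cl, of z] by auto
    have "cinner (adj T (z - T x)) m = 0" for m
      using x cinner_conj[of _ "T m"] by (simp add: adj_cinner'[OF T, symmetric])
    then have "adj T (z - T x) = 0" using cinner_eq_zero_iff by blast
    then show ?thesis using z by (auto simp: bop_diff[OF T'])
  qed
  ultimately show ?thesis by (auto simp: bij_def inj_def surj_def) metis
qed

lemma bop_mp_inv:
  assumes "left_invertible T" "closed (range T)"
  shows "bop (mp_inv T)"
  using assms unfolding mp_inv_def left_invertible_def
  by (intro bop_comp bop_inv gram_bij) (auto simp: bop_adj bop_comp left_invertible_def)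

lemma mp_inv_left:
  assumes "left_invertible T" "closed (range T)"
  shows "mp_inv T (T x) = x"
  using inv_f_f[OF bij_is_inj[OF gram_bij[OF assms]], of x] by (simp add: mp_inv_def)

text \<open>\<open>T \<circ> mp_inv T\<close> is the orthogonal projection onto the range of
  \<open>T\<close>. The remainder lies in the one-dimensional kernel of \<open>adj T\<close>, and
  pairing with \<open>e\<close> gives its coefficient.\<close>

lemma mp_inv_defect:
  fixes T :: "'a::complex_hilbert \<Rightarrow> 'a"
  assumes li: "left_invertible T" and cl: "closed (range T)" and ind: "fredholm_index T = -1"
  obtains e where "norm e = 1" "\<And>x. x - T (mp_inv T x) = rank_one e e x"
proof -
  have T: "bop T" using li by (simp add: left_invertible_def)
  note T' = bop_adj[OF T]
  obtain e where e: "norm e = 1" "adj T e = 0" "\<And>x. adj T x = 0 \<Longrightarrow> \<exists>c. x = scaleC c e"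
    using one_dimensional_kernel[OF T' index_minus_one_cokernel[OF li ind]] by blast
  have "x - T (mp_inv T x) = rank_one e e x" for x
  proof -
    have "adj T (T (mp_inv T x)) = adj T x"
      using surj_f_inv_f[OF bij_is_surj[OF gram_bij[OF li cl]], of "adj T x"] by (simp add: mp_inv_def)
    then obtain c where c: "x - T (mp_inv T x) = scaleC c e"
      using e(3)[of "x - T (mp_inv T x)"] by (auto simp: bop_diff[OF T'])
    have "cinner e (x - T (mp_inv T x)) = cinner e x"
      by (simp add: cinner_diff_right adj_cinner'[OF T] e(2))
    then have "c = cinner e x" using e(1) by (simp add: c cinner_scaleC_right cinner_self)
    then show ?thesis by (simp add: c rank_one_def)
  qed
  with e(1) show ?thesis by (rule that)
qed

section \<open>Closure properties of \<open>mp_alg\<close>\<close>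

lemma bop_alg_gen: "bop T \<Longrightarrow> bop S \<Longrightarrow> A \<in> alg_gen T S \<Longrightarrow> bop A"
  by (erule alg_gen.induct) (blast intro: bop_plus bop_scale bop_comp)+

lemma mp_alg_bop: "A \<in> mp_alg T \<Longrightarrow> bop A"
  by (simp add: mp_alg_def)

lemma onorm_diff_triangle:
  assumes "bop A" "bop B" "bop C"
  shows "onorm (\<lambda>x. A x - C x) \<le> onorm (\<lambda>x. A x - B x) + onorm (\<lambda>x. B x - C x)"
  using onorm_triangle[of "\<lambda>x. A x - B x" "\<lambda>x. B x - C x"] assms
  by (simp add: bop_bounded_linear bounded_linear_sub)

lemma alg_gen_mp_alg:
  assumes "bop T" "bop (mp_inv T)" "A \<in> alg_gen T (mp_inv T)"
  shows "A \<in> mp_alg T"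
  unfolding mp_alg_def using assms bop_alg_gen[OF assms] by (auto simp: onorm_zero intro!: bexI[of _ A])

lemma mp_alg_closed:
  assumes T: "bop T" and L: "bop (mp_inv T)" and A: "bop A"
    and approx: "\<And>d. d > 0 \<Longrightarrow> \<exists>B\<in>mp_alg T. onorm (\<lambda>x. A x - B x) < d"
  shows "A \<in> mp_alg T"
  unfolding mp_alg_def
proof (intro CollectI conjI A allI impI)
  fix d :: real assume "d > 0"
  then have d: "d / 2 > 0" by simp
  obtain B where B: "B \<in> mp_alg T" "onorm (\<lambda>x. A x - B x) < d / 2" using approx[OF d] by blast
  then obtain C where C: "C \<in> alg_gen T (mp_inv T)" "onorm (\<lambda>x. B x - C x) < d / 2"
    using d unfolding mp_alg_def by blast
  have "onorm (\<lambda>x. A x - C x) < d"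
    using onorm_diff_triangle[OF A mp_alg_bop[OF B(1)] bop_alg_gen[OF T L C(1)]] B(2) C(2) by linarith
  with C(1) show "\<exists>C\<in>alg_gen T (mp_inv T). onorm (\<lambda>x. A x - C x) < d" by blast
qed

lemma mp_alg_add:
  assumes T: "bop T" and L: "bop (mp_inv T)" and A: "A \<in> mp_alg T" and B: "B \<in> mp_alg T"
  shows "(\<lambda>x. A x + B x) \<in> mp_alg T"
  unfolding mp_alg_def
proof (intro CollectI conjI allI impI)
  note bA = mp_alg_bop[OF A] and bB = mp_alg_bop[OF B]
  show "bop (\<lambda>x. A x + B x)" by (rule bop_plus[OF bA bB])
  fix d :: real assume "d > 0"
  then have d: "d / 2 > 0" by simp
  obtain A' where A': "A' \<in> alg_gen T (mp_inv T)" "onorm (\<lambda>x. A x - A' x) < d / 2"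
    using A d unfolding mp_alg_def by blast
  obtain B' where B': "B' \<in> alg_gen T (mp_inv T)" "onorm (\<lambda>x. B x - B' x) < d / 2"
    using B d unfolding mp_alg_def by blast
  have "onorm (\<lambda>x. (A x - A' x) + (B x - B' x)) \<le> onorm (\<lambda>x. A x - A' x) + onorm (\<lambda>x. B x - B' x)"
    by (intro onorm_triangle bop_bounded_linear bop_minus bA bB bop_alg_gen[OF T L] A'(1) B'(1))
  then have "onorm (\<lambda>x. (A x + B x) - (A' x + B' x)) < d"
    using A'(2) B'(2) by (simp add: algebra_simps)
  then show "\<exists>C\<in>alg_gen T (mp_inv T). onorm (\<lambda>x. A x + B x - C x) < d"
    by (rule bexI[OF _ gen_add[OF A'(1) B'(1)]])
qed

lemma mp_alg_comp:
  assumes T: "bop T" and L: "bop (mp_inv T)" and A: "A \<in> mp_alg T" and B: "B \<in> mp_alg T"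
  shows "A \<circ> B \<in> mp_alg T"
  unfolding mp_alg_def
proof (intro CollectI conjI allI impI)
  note bA = mp_alg_bop[OF A] and bB = mp_alg_bop[OF B]
  show "bop (A \<circ> B)" by (rule bop_comp[OF bA bB])
  fix d :: real assume d: "d > 0"
  have nA: "0 \<le> onorm A" by (rule onorm_pos_le[OF bop_bounded_linear[OF bA]])
  \<comment> \<open>\<open>B'\<close> is chosen before \<open>A'\<close>, because the tolerance for
    \<open>A'\<close> depends on \<open>onorm B'\<close>. Adding 1 keeps the denominators positive
    when a norm vanishes.\<close>
  have dA: "d / (2 * (onorm A + 1)) > 0" using d nA by simp
  obtain B' where B': "B' \<in> alg_gen T (mp_inv T)" "onorm (\<lambda>x. B x - B' x) < d / (2 * (onorm A + 1))"
    using B dA unfolding mp_alg_def by blast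
  note bB' = bop_alg_gen[OF T L B'(1)]
  have nB: "0 \<le> onorm B'" by (rule onorm_pos_le[OF bop_bounded_linear[OF bB']])
  have dB: "d / (2 * (onorm B' + 1)) > 0" using d nB by simp
  obtain A' where A': "A' \<in> alg_gen T (mp_inv T)" "onorm (\<lambda>x. A x - A' x) < d / (2 * (onorm B' + 1))"
    using A dB unfolding mp_alg_def by blast
  note bA' = bop_alg_gen[OF T L A'(1)]
  \<comment> \<open>The usual splitting \<open>AB - A'B' = A(B - B') + (A - A')B'\<close>, each
    summand below \<open>d / 2\<close>.\<close>
  have "(\<lambda>x. (A \<circ> B) x - (A' \<circ> B') x) = (\<lambda>x. (A \<circ> (\<lambda>x. B x - B' x)) x + ((\<lambda>x. A x - A' x) \<circ> B') x)"
    by (simp add: fun_eq_iff bop_diff[OF bA])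
  then have "onorm (\<lambda>x. (A \<circ> B) x - (A' \<circ> B') x)
      \<le> onorm (A \<circ> (\<lambda>x. B x - B' x)) + onorm ((\<lambda>x. A x - A' x) \<circ> B')"
    using onorm_triangle[OF bop_bounded_linear[OF bop_comp[OF bA bop_minus[OF bB bB']]]
        bop_bounded_linear[OF bop_comp[OF bop_minus[OF bA bA'] bB']]] by simp
  also have "onorm (A \<circ> (\<lambda>x. B x - B' x)) \<le> onorm A * onorm (\<lambda>x. B x - B' x)"
    by (intro onorm_compose bop_bounded_linear bA bop_minus bB bB')
  also have "onorm A * onorm (\<lambda>x. B x - B' x) \<le> onorm A * (d / (2 * (onorm A + 1)))"
    using B'(2) nA by (intro mult_left_mono) auto
  also have "onorm A * (d / (2 * (onorm A + 1))) < d / 2"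
    using d nA by (simp add: field_simps)
  also have "onorm ((\<lambda>x. A x - A' x) \<circ> B') \<le> onorm (\<lambda>x. A x - A' x) * onorm B'"
    by (intro onorm_compose bop_bounded_linear bA bop_minus bA' bB')
  also have "onorm (\<lambda>x. A x - A' x) * onorm B' \<le> d / (2 * (onorm B' + 1)) * onorm B'"
    using A'(2) nB by (intro mult_right_mono) auto
  also have "d / (2 * (onorm B' + 1)) * onorm B' < d / 2"
    using d nB by (simp add: field_simps)
  finally have "onorm (\<lambda>x. (A \<circ> B) x - (A' \<circ> B') x) < d" by simp
  then show "\<exists>C\<in>alg_gen T (mp_inv T). onorm (\<lambda>x. (A \<circ> B) x - C x) < d"
    by (rule bexI[OF _ gen_mult[OF A'(1) B'(1)]])
qed

lemma mp_alg_scaleC: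
  assumes T: "bop T" and L: "bop (mp_inv T)" and A: "A \<in> mp_alg T"
    and id: "id \<in> alg_gen T (mp_inv T)"
  shows "(\<lambda>x. scaleC c (A x)) \<in> mp_alg T"
  using mp_alg_comp[OF T L alg_gen_mp_alg[OF T L gen_smult[OF id, of c]] A] by (simp add: comp_def)

text \<open>This is where analyticity enters: it excludes a nonzero vector orthogonal to all
  admissible \<open>g\<close>.\<close>

lemma rank_one_mp_alg:
  fixes T :: "'a::complex_hilbert \<Rightarrow> 'a"
  assumes li: "left_invertible T" and cl: "closed (range T)" and an: "analytic_op T"
    and defect: "\<And>x. x - T (mp_inv T x) = rank_one e e x" and e: "norm e = 1"
  shows "rank_one e g \<in> mp_alg T"
proof -
  let ?L = "mp_inv T"
  have T: "bop T" using li by (simp add: left_invertible_def)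
  note L = bop_mp_inv[OF li cl]
  have LT: "?L \<circ> T = id" by (simp add: fun_eq_iff mp_inv_left[OF li cl])
  \<comment> \<open>\<open>alg_gen\<close> has no rule for the identity; it arises as the product of
    the left inverse and \<open>T\<close>.\<close>
  have id: "id \<in> alg_gen T ?L" unfolding LT[symmetric] by (rule gen_mult[OF gen_S gen_T])
  have "(\<lambda>x. id x + scaleC (-1) ((T \<circ> ?L) x)) \<in> alg_gen T ?L"
    by (intro gen_add id gen_smult gen_mult gen_T gen_S)
  moreover have "(\<lambda>x. id x + scaleC (-1) ((T \<circ> ?L) x)) = rank_one e e"
    by (simp add: fun_eq_iff defect[symmetric])
  ultimately have P: "rank_one e e \<in> mp_alg T" by (metis alg_gen_mp_alg[OF T L])
  have Ln: "?L ^^ n \<in> mp_alg T" for n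
  proof (induction n)
    case 0
    show ?case using alg_gen_mp_alg[OF T L id] by (simp add: id_def[symmetric])
  next
    case (Suc n)
    show ?case using mp_alg_comp[OF T L alg_gen_mp_alg[OF T L gen_S] Suc] by (simp only: funpow.simps)
  qed

  define G where "G = {g. rank_one e g \<in> mp_alg T}"
  have f: "adj (?L ^^ n) e \<in> G" for n
    unfolding G_def using mp_alg_comp[OF T L P Ln[of n]] by (simp add: rank_one_comp[OF bop_funpow[OF L]])
  have sub: "csubspace G"
    unfolding csubspace_def
  proof (intro conjI ballI allI)
    show sc: "scaleC c x \<in> G" if "x \<in> G" for c x
      using mp_alg_scaleC[OF T L _ id] that by (simp add: G_def rank_one_scaleC_right)
    show "x + y \<in> G" if "x \<in> G" "y \<in> G" for x y
      using mp_alg_add[OF T L] that by (simp add: G_def rank_one_add_right)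
    show "0 \<in> G" using sc[OF f[of 0], of 0] by simp
  qed
  \<comment> \<open>As \<open>norm e = 1\<close>, the map from \<open>g\<close> to
    \<open>rank_one e g\<close> preserves distances, so closedness of \<open>mp_alg T\<close> passes
    to \<open>G\<close>.\<close>
  have "closure G \<subseteq> G"
  proof
    fix g assume g: "g \<in> closure G"
    have "rank_one e g \<in> mp_alg T"
    proof (rule mp_alg_closed[OF T L bop_rank_one])
      fix d :: real assume "d > 0"
      then obtain h where h: "h \<in> G" "dist h g < d" using g by (auto simp: closure_approachable)
      have "(\<lambda>x. rank_one e g x - rank_one e h x) = rank_one e (g - h)"
        by (simp add: rank_one_def cinner_diff_left cvs.scale_left_diff_distrib)
      then have "onorm (\<lambda>x. rank_one e g x - rank_one e h x) < d"
        using h(2) by (simp add: onorm_rank_one e dist_norm norm_minus_commute)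
      with h(1) show "\<exists>B\<in>mp_alg T. onorm (\<lambda>x. rank_one e g x - B x) < d" by (auto simp: G_def)
    qed
    then show "g \<in> G" by (simp add: G_def)
  qed
  then have Gcl: "closed G" by (simp add: closure_subset_eq)

  from orthogonal_decomposition[OF sub Gcl, of g]
  obtain p where p: "p \<in> G" and orth: "\<forall>m\<in>G. cinner m (g - p) = 0" ..
  define y where "y = g - p"
  \<comment> \<open>Orthogonality of \<open>y\<close> to \<open>adj (?L ^^ n) e\<close> means that
    \<open>e\<close> is orthogonal to \<open>(?L ^^ n) y\<close>, so the defect
    \<open>I - T ?L\<close> vanishes there.\<close>
  have step: "(?L ^^ n) y = T ((?L ^^ Suc n) y)" for n
  proof -
    have "cinner e ((?L ^^ n) y) = 0"
      using orth f[of n] by (simp add: y_def adj_cinner'[OF bop_funpow[OF L]])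
    then have "(?L ^^ n) y - T (?L ((?L ^^ n) y)) = 0" by (simp add: defect rank_one_def)
    then show ?thesis by simp
  qed
  have recover: "(T ^^ n) ((?L ^^ n) y) = y" for n
  proof (induction n)
    case (Suc n)
    have "(T ^^ Suc n) ((?L ^^ Suc n) y) = (T ^^ n) (T ((?L ^^ Suc n) y))"
      by (simp only: funpow_Suc_right o_apply)
    also have "\<dots> = (T ^^ n) ((?L ^^ n) y)" by (simp only: step[symmetric])
    also have "\<dots> = y" by (rule Suc)
    finally show ?case .
  qed simp
  have "y \<in> range (T ^^ n)" for n
    using rangeI[of "T ^^ n" "(?L ^^ n) y"] unfolding recover .
  then have "y \<in> (\<Inter>n\<in>{1..}. range (T ^^ n))" by blast
  then have "y = 0" using an unfolding analytic_op_def by (simp only: singleton_iff)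
  then have "g \<in> G" using p by (simp add: y_def)
  then show ?thesis by (simp add: G_def)
qed

theorem theoremB:
  fixes T1 T2 :: "'a::complex_hilbert \<Rightarrow> 'a"
    and \<phi> :: "('a \<Rightarrow> 'a) \<Rightarrow> ('a \<Rightarrow> 'a)"
  assumes "left_invertible T1" and "analytic_op T1"
    and "fredholm T1" and "fredholm_index T1 = -1"
    and "left_invertible T2" and "analytic_op T2"
    and "fredholm T2" and "fredholm_index T2 = -1"
    and "bounded_alg_iso \<phi> (mp_alg T1) (mp_alg T2)"
  shows "\<exists>V. invertible_op V \<and> (\<forall>A\<in>mp_alg T1. \<phi> A = V \<circ> A \<circ> inv V)"
proof -
  \<comment> \<open>The Fredholm property supplies the closed ranges on which the facts about
    \<open>mp_inv\<close> rest.\<close>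
  have T1: "bop T1" and cl1: "closed (range T1)" and T2: "bop T2" and cl2: "closed (range T2)"
    using assms by (auto simp: fredholm_def)
  obtain e1 where e1: "norm e1 = 1" "\<And>x. x - T1 (mp_inv T1 x) = rank_one e1 e1 x"
    using mp_inv_defect[OF assms(1) cl1 assms(4)] by blast
  obtain e2 where e2: "norm e2 = 1" "\<And>x. x - T2 (mp_inv T2 x) = rank_one e2 e2 x"
    using mp_inv_defect[OF assms(5) cl2 assms(8)] by blast
  \<comment> \<open>Rank-one operators are supplied on both sides: those of \<open>T1\<close> define
    \<open>W\<close>, while those of \<open>T2\<close> have preimages under \<open>\<phi>\<close>
    and thus make \<open>W\<close> onto.\<close>
  show ?thesis
    by (rule spatial_if_rank_one[OF mp_alg_bop
          mp_alg_comp[OF T1 bop_mp_inv[OF assms(1) cl1]]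
          rank_one_mp_alg[OF assms(1) cl1 assms(2) e1(2) e1(1)] e1(1)
          mp_alg_bop mp_alg_comp[OF T2 bop_mp_inv[OF assms(5) cl2]]
          rank_one_mp_alg[OF assms(5) cl2 assms(6) e2(2) e2(1)] e2(1) assms(9)])
qed

end
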